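(* Let $g=\nabla_x\ell\in\mathbb{R}^d$ be a non-null gradient, with normalized gradient components $\pi_i=|g_i|/\|g\|_1$, $i=1,\dots,d$. For $q=1+\epsilon$ with small $\epsilon$, the cosine similarity between the $l^2$ and $l^p$ perturbations, $$\cos(\theta_{2,p})=\frac{\|g\|_q^q}{\|g\|_2\,\|g\|_{2(q-1)}^{\,q-1}},$$ admits the following first-order expansion: $$\cos(\theta_{2,p})=\sqrt{\frac{\mathrm{PR}_1}{d}}\,\bigl(1+\epsilon(H_m-H)\bigr)+O(\epsilon^2),$$ where $\mathrm{PR}_1=\left(\|g\|_1/\|g\|_2\right)^2$ is the participation ratio, $H=-\sum_{i=1}^d\pi_i\log\pi_i$ is the Shannon entropy, and $H_m=-\log\prod_{i=1}^d\pi_i^{1/d}$ is the logarithmic mean entropy.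
   Context: Here $\ell$ is a loss function, $x\in\mathbb{R}^d$ is its input, and $\nabla_x\ell$ is the gradient with respect to the input. The exponents $p\ge 2$ and $q\in[1,2]$ are dual: $\frac1p+\frac1q=1$. For $r>0$ (including $r<1$), $\|v\|_r=(\sum_{i=1}^d|v_i|^r)^{1/r}$, so that $\|g\|_{2(q-1)}^{q-1}=\bigl(\sum_i|g_i|^{2(q-1)}\bigr)^{1/2}$. The cosine $\cos(\theta_{2,p})$ is that of the angle between the $l^2$ perturbation, which is a positive multiple of $g$, and the single-step $l^p$ perturbation, which is a positive multiple of $\operatorname{sign}(g)\,|g|^{q-1}$ (operations element-wise).
   Formalization: The expansion is stated only when every normalized component π_i is positive; if some g_i = 0, H_m is infinite and the expansion has no meaning (g = (1,0) gives cosine 1, but leading term √(1/2)). *)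

theory Defs
  imports "HOL-Analysis.Analysis" "HOL-Library.Landau_Symbols"
begin

(* For r < 1 this is not a norm; the formula is meant for every real r > 0. *)
definition lp_norm :: "real \<Rightarrow> real ^ 'd \<Rightarrow> real" where
  "lp_norm r v = (\<Sum>i\<in>UNIV. \<bar>v $ i\<bar> powr r) powr (1 / r)"

lemma lp_norm_powr_half:
  assumes "q > 1"
  shows "lp_norm (2 * (q - 1)) g powr (q - 1) = sqrt (\<Sum>i\<in>UNIV. \<bar>g $ i\<bar> powr (2 * (q - 1)))"
proof -
  have "1 / (2 * (q - 1)) * (q - 1) = 1 / 2"
    using assms by (simp add: field_simps)
  then show ?thesis
    by (simp only: lp_norm_def powr_powr powr_half_sqrt sum_nonneg powr_ge_zero)
qed

definition dual_exponent :: "real \<Rightarrow> real" where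
  "dual_exponent r = r / (r - 1)"

lemma dual_exponent_eq_iff:
  assumes "p > 1"
  shows "q = dual_exponent p \<longleftrightarrow> 1 / p + 1 / q = 1"
  using assms by (cases "q = 0") (auto simp: dual_exponent_def field_simps)

definition cosine_similarity :: "'a::real_inner \<Rightarrow> 'a \<Rightarrow> real" where
  "cosine_similarity u v = (u \<bullet> v) / (norm u * norm v)"

(* Perturbations are determined by the gradient g only up to their size, hence
   up to a positive factor. *)
definition l2_perturbation :: "real ^ 'd \<Rightarrow> real ^ 'd \<Rightarrow> bool" where
  "l2_perturbation g \<delta> \<longleftrightarrow> (\<exists>a>0. \<delta> = a *\<^sub>R g)"

definition lp_perturbation :: "real \<Rightarrow> real ^ 'd \<Rightarrow> real ^ 'd \<Rightarrow> bool" where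
  "lp_perturbation p g \<delta> \<longleftrightarrow>
     (\<exists>a>0. \<delta> = a *\<^sub>R (\<chi> i. sgn (g $ i) * \<bar>g $ i\<bar> powr (dual_exponent p - 1)))"

definition normalized_component :: "real ^ 'd \<Rightarrow> 'd \<Rightarrow> real" where
  "normalized_component g i = \<bar>g $ i\<bar> / lp_norm 1 g"

definition participation_ratio :: "real ^ 'd \<Rightarrow> real" where
  "participation_ratio g = (lp_norm 1 g / lp_norm 2 g)\<^sup>2"

(* Since ln 0 = 0, a vanishing component contributes 0, the usual convention. *)
definition shannon_entropy :: "real ^ 'd \<Rightarrow> real" where
  "shannon_entropy g = - (\<Sum>i\<in>UNIV. normalized_component g i * ln (normalized_component g i))"

(* Meaningful only if no component of g vanishes: otherwise the mathematical
   value is infinite, whereas ln 0 = 0 here. *)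
definition log_mean_entropy :: "real ^ 'd \<Rightarrow> real" where
  "log_mean_entropy g =
     - ln (\<Prod>i\<in>UNIV. normalized_component g i powr (1 / real CARD('d)))"

end

theory Submission
  imports Defs
begin

text \<open>
  The cosine similarity ignores the positive step sizes, which gives the closed form
  \<open>N \<epsilon> / (\<parallel>g\<parallel>\<^sub>2 * sqrt (D \<epsilon>))\<close> with \<open>N \<epsilon> = (\<Sum>i. \<bar>g\<^sub>i\<bar> powr (1 + \<epsilon>))\<close> and
  \<open>D \<epsilon> = (\<Sum>i. \<bar>g\<^sub>i\<bar> powr (2 * \<epsilon>))\<close>. If no component vanishes, this is smooth at \<open>0\<close>, with
  value \<open>\<parallel>g\<parallel>\<^sub>1 / (\<parallel>g\<parallel>\<^sub>2 * sqrt d)\<close> and logarithmic derivative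
  \<open>(\<Sum>i. \<pi>\<^sub>i * ln \<bar>g\<^sub>i\<bar>) - (\<Sum>i. ln \<bar>g\<^sub>i\<bar>) / d\<close>. The normalization \<open>\<bar>g\<^sub>i\<bar> = \<parallel>g\<parallel>\<^sub>1 * \<pi>\<^sub>i\<close> cancels in
  this difference, leaving \<open>H\<^sub>m - H\<close>.
\<close>

text \<open>Differentiability of \<open>f'\<close> at \<open>a\<close> makes
  \<open>f' x - f' a\<close> at most a constant times \<open>x - a\<close> near \<open>a\<close>.
  The mean value inequality then supplies the second factor \<open>x - a\<close>.\<close>

lemma taylor_first_order_bigo:
  fixes f f' :: "real \<Rightarrow> real"
  assumes f: "\<forall>\<^sub>F x in nhds a. (f has_real_derivative f' x) (at x)"
    and f': "(f' has_real_derivative k) (at a)"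
  shows "(\<lambda>x. f x - (f a + f' a * (x - a))) \<in> O[at a](\<lambda>x. (x - a)\<^sup>2)"
proof -
  have "((\<lambda>x. (f' x - f' a) / (x - a)) \<longlongrightarrow> k) (at a)"
    using f' by (simp add: has_field_derivative_iff)
  \<comment> \<open>The summand \<open>1\<close> puts the bound strictly above the limit
    \<open>norm k\<close>, so the quotients eventually stay below it.\<close>
  from tendsto_norm[OF this] have "\<forall>\<^sub>F x in at a. norm ((f' x - f' a) / (x - a)) < norm k + 1"
    by (rule order_tendstoD) simp
  then have "\<forall>\<^sub>F x in at a. \<bar>f' x - f' a\<bar> \<le> (\<bar>k\<bar> + 1) * \<bar>x - a\<bar>"
    using eventually_neq_at_within[of a a UNIV]
    by eventually_elim (simp add: divide_less_eq)
  \<comment> \<open>At \<open>x = a\<close> both sides are 0. The full neighbourhood matters because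
    the segments used below contain \<open>a\<close>.\<close>
  then have "\<forall>\<^sub>F x in nhds a. \<bar>f' x - f' a\<bar> \<le> (\<bar>k\<bar> + 1) * \<bar>x - a\<bar>"
    unfolding eventually_at_filter by (rule eventually_mono) (cases, auto)
  with f have "\<forall>\<^sub>F x in nhds a. (f has_real_derivative f' x) (at x) \<and>
      \<bar>f' x - f' a\<bar> \<le> (\<bar>k\<bar> + 1) * \<bar>x - a\<bar>"
    by (rule eventually_conj)
  then obtain r where r: "r > 0"
    and deriv: "\<And>x. dist x a < r \<Longrightarrow> (f has_real_derivative f' x) (at x)"
    and bound: "\<And>x. dist x a < r \<Longrightarrow> \<bar>f' x - f' a\<bar> \<le> (\<bar>k\<bar> + 1) * \<bar>x - a\<bar>"
    unfolding eventually_nhds_metric by blast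
  show ?thesis
  proof (rule bigoI)
    show "\<forall>\<^sub>F x in at a. norm (f x - (f a + f' a * (x - a))) \<le> (\<bar>k\<bar> + 1) * norm ((x - a)\<^sup>2)"
      unfolding eventually_at
    proof (intro exI conjI ballI impI)
      fix x assume "x \<noteq> a \<and> dist x a < r"
      have near: "dist y a \<le> dist x a" if "y \<in> closed_segment a x" for y
        using dist_in_closed_segment(1)[OF that] by (simp add: dist_commute)
      \<comment> \<open>Subtracting the linear part leaves the derivative
        \<open>f' y - f' a\<close>. It is bounded uniformly on the segment, since no point
        \<open>y\<close> there is farther from \<open>a\<close> than \<open>x\<close>.\<close>
      have "norm ((\<lambda>y. f y - f' a * y) x - (\<lambda>y. f y - f' a * y) a)
          \<le> (\<bar>k\<bar> + 1) * \<bar>x - a\<bar> * norm (x - a)"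
      proof (rule field_differentiable_bound[where S = "closed_segment a x"])
        fix y assume y: "y \<in> closed_segment a x"
        have yr: "dist y a < r" and yx: "\<bar>y - a\<bar> \<le> \<bar>x - a\<bar>"
          using near[OF y] \<open>x \<noteq> a \<and> dist x a < r\<close> by (simp_all add: dist_real_def)
        show "((\<lambda>y. f y - f' a * y) has_field_derivative f' y - f' a) (at y within closed_segment a x)"
          using has_field_derivative_at_within[OF deriv[OF yr]]
          by (auto intro!: derivative_eq_intros)
        have "norm (f' y - f' a) \<le> (\<bar>k\<bar> + 1) * \<bar>y - a\<bar>"
          using bound[OF yr] by simp
        also have "\<dots> \<le> (\<bar>k\<bar> + 1) * \<bar>x - a\<bar>"
          using yx by (intro mult_left_mono) auto
        finally show "norm (f' y - f' a) \<le> (\<bar>k\<bar> + 1) * \<bar>x - a\<bar>" .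
      qed auto
      moreover have "(\<bar>k\<bar> + 1) * \<bar>x - a\<bar> * norm (x - a) = (\<bar>k\<bar> + 1) * norm ((x - a)\<^sup>2)"
        by (simp add: power2_eq_square abs_mult)
      moreover have "(\<lambda>y. f y - f' a * y) x - (\<lambda>y. f y - f' a * y) a = f x - (f a + f' a * (x - a))"
        by (simp add: algebra_simps)
      ultimately show "norm (f x - (f a + f' a * (x - a))) \<le> (\<bar>k\<bar> + 1) * norm ((x - a)\<^sup>2)"
        by argo
    qed (use r in auto)
  qed
qed

lemma cosine_similarity_scaleR:
  assumes "a > 0" "b > 0"
  shows "cosine_similarity (a *\<^sub>R u) (b *\<^sub>R v) = cosine_similarity u v"
  using assms by (simp add: cosine_similarity_def)

lemma lp_norm_1: "lp_norm 1 g = (\<Sum>i\<in>UNIV. \<bar>g $ i\<bar>)"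
  by (simp add: lp_norm_def sum_nonneg)

lemma lp_norm_2: "lp_norm 2 g = norm g"
  by (simp add: lp_norm_def norm_vec_def L2_set_def powr_half_sqrt sum_nonneg)

lemma lp_norm_powr_self:
  assumes "q > 0"
  shows "lp_norm q g powr q = (\<Sum>i\<in>UNIV. \<bar>g $ i\<bar> powr q)"
  using assms by (simp add: lp_norm_def powr_powr sum_nonneg)

text \<open>The step sizes cancel, leaving the angle between \<open>g\<close> and the signed power
  \<open>w\<close>. Componentwise, \<open>g * sgn g\<close> is the absolute value, which raises the
  exponent \<open>q - 1\<close> to \<open>q\<close> in the inner product. Vanishing components
  contribute 0 throughout, as \<open>0 powr r = 0\<close>.\<close>

lemma cosine_similarity_perturbations:
  assumes l2: "l2_perturbation g u" and lp: "lp_perturbation p g v"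
    and q: "dual_exponent p = q" "q > 1"
  shows "cosine_similarity u v =
    (\<Sum>i\<in>UNIV. \<bar>g $ i\<bar> powr q) / (norm g * sqrt (\<Sum>i\<in>UNIV. \<bar>g $ i\<bar> powr (2 * (q - 1))))"
proof -
  define w where "w = (\<chi> i. sgn (g $ i) * \<bar>g $ i\<bar> powr (q - 1))"
  from l2 lp q obtain a b where "a > 0" "u = a *\<^sub>R g" "b > 0" "v = b *\<^sub>R w"
    unfolding l2_perturbation_def lp_perturbation_def w_def by blast
  then have "cosine_similarity u v = cosine_similarity g w"
    by (simp add: cosine_similarity_scaleR)
  moreover have "g \<bullet> w = (\<Sum>i\<in>UNIV. \<bar>g $ i\<bar> powr q)"
    unfolding inner_vec_def
  proof (rule sum.cong)
    fix i
    have "\<bar>g $ i\<bar> powr 1 * \<bar>g $ i\<bar> powr (q - 1) = \<bar>g $ i\<bar> powr q"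
      by (simp only: powr_add[symmetric]) simp
    then show "g $ i \<bullet> w $ i = \<bar>g $ i\<bar> powr q"
      by (simp add: w_def mult.assoc[symmetric] flip: abs_sgn)
  qed simp
  moreover have "norm w = sqrt (\<Sum>i\<in>UNIV. \<bar>g $ i\<bar> powr (2 * (q - 1)))"
    unfolding norm_vec_def L2_set_def
  proof (intro arg_cong[where f = sqrt] sum.cong)
    fix i
    have "(norm (w $ i))\<^sup>2 = (\<bar>g $ i\<bar> powr (q - 1))\<^sup>2"
      by (cases "g $ i = 0") (simp_all add: w_def abs_mult abs_sgn_eq)
    also have "\<dots> = \<bar>g $ i\<bar> powr (2 * (q - 1))"
      by (simp add: power2_eq_square powr_add[symmetric])
    finally show "(norm (w $ i))\<^sup>2 = \<bar>g $ i\<bar> powr (2 * (q - 1))" .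
  qed simp
  ultimately show ?thesis
    by (simp add: cosine_similarity_def)
qed

text \<open>Both entropies are averages of \<open>- ln\<close> of the normalized components, one
  with uniform weights and the other with the components themselves as weights. Each family of
  weights sums to one, so each average contains \<open>ln S\<close> exactly once.\<close>

lemma entropy_difference:
  fixes g :: "real ^ 'd"
  assumes pos: "\<And>i. normalized_component g i > 0"
  shows "log_mean_entropy g - shannon_entropy g =
    (\<Sum>i\<in>UNIV. \<bar>g $ i\<bar> * ln \<bar>g $ i\<bar>) / (\<Sum>i\<in>UNIV. \<bar>g $ i\<bar>)
      - (\<Sum>i\<in>UNIV. ln \<bar>g $ i\<bar>) / real CARD('d)"
proof -
  define S where "S = (\<Sum>i\<in>UNIV. \<bar>g $ i\<bar>)"
  have pi: "normalized_component g i = \<bar>g $ i\<bar> / S" for i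
    by (simp add: normalized_component_def lp_norm_1 S_def)
  have "S \<ge> 0" by (simp add: S_def sum_nonneg)
  \<comment> \<open>As \<open>S\<close> is nonnegative, a quotient by \<open>S\<close> can be
    positive only if numerator and \<open>S\<close> are both positive.\<close>
  with pos have g: "\<bar>g $ i\<bar> > 0" and "S > 0" for i
    unfolding pi zero_less_divide_iff by (metis not_less)+
  have ln_pi: "ln (\<bar>g $ i\<bar> / S) = ln \<bar>g $ i\<bar> - ln S" for i
    using g \<open>S > 0\<close> by (intro ln_divide_pos) auto
  have "log_mean_entropy g = - (\<Sum>i\<in>UNIV. ln (\<bar>g $ i\<bar> / S) / real CARD('d))"
    using g \<open>S > 0\<close> unfolding log_mean_entropy_def pi
    by (subst ln_prod) (auto simp: ln_powr less_imp_neq[symmetric])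
  also have "\<dots> = ln S - (\<Sum>i\<in>UNIV. ln \<bar>g $ i\<bar>) / real CARD('d)"
    by (simp add: ln_pi sum_divide_distrib[symmetric] sum_subtractf diff_divide_distrib)
  finally have 1: "log_mean_entropy g = ln S - (\<Sum>i\<in>UNIV. ln \<bar>g $ i\<bar>) / real CARD('d)" .
  have "shannon_entropy g = - ((\<Sum>i\<in>UNIV. \<bar>g $ i\<bar> * ln \<bar>g $ i\<bar>) - (\<Sum>i\<in>UNIV. \<bar>g $ i\<bar>) * ln S) / S"
    unfolding shannon_entropy_def pi ln_pi
    by (simp add: sum_divide_distrib sum_subtractf right_diff_distrib sum_distrib_right diff_divide_distrib)
  also have "\<dots> = ln S - (\<Sum>i\<in>UNIV. \<bar>g $ i\<bar> * ln \<bar>g $ i\<bar>) / S"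
    using \<open>S > 0\<close> by (simp add: S_def[symmetric] field_simps)
  finally show ?thesis
    using 1 by (simp add: S_def)
qed

lemma power_sum_ratio_expansion:
  fixes a :: "'d::finite \<Rightarrow> real"
  assumes a: "\<And>i. a i > 0"
  shows "(\<lambda>\<epsilon>. (\<Sum>i\<in>UNIV. a i powr (1 + \<epsilon>)) / (c * sqrt (\<Sum>i\<in>UNIV. a i powr (2 * \<epsilon>)))
      - (\<Sum>i\<in>UNIV. a i) / (c * sqrt (real CARD('d)))
        * (1 + \<epsilon> * ((\<Sum>i\<in>UNIV. a i * ln (a i)) / (\<Sum>i\<in>UNIV. a i)
          - (\<Sum>i\<in>UNIV. ln (a i)) / real CARD('d))))
    \<in> O[at 0](\<lambda>\<epsilon>. \<epsilon>\<^sup>2)"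
proof -
  \<comment> \<open>Primes mark derivatives. The second derivatives serve to show that
    \<open>F'\<close> is differentiable at 0; their values do not enter the expansion.\<close>
  define N where "N \<epsilon> = (\<Sum>i\<in>UNIV. a i powr (1 + \<epsilon>))" for \<epsilon>
  define N' where "N' \<epsilon> = (\<Sum>i\<in>UNIV. a i powr (1 + \<epsilon>) * ln (a i))" for \<epsilon>
  define N'' where "N'' \<epsilon> = (\<Sum>i\<in>UNIV. a i powr (1 + \<epsilon>) * ln (a i) * ln (a i))" for \<epsilon>
  define D where "D \<epsilon> = (\<Sum>i\<in>UNIV. a i powr (2 * \<epsilon>))" for \<epsilon>
  define D' where "D' \<epsilon> = (\<Sum>i\<in>UNIV. a i powr (2 * \<epsilon>) * (2 * ln (a i)))" for \<epsilon>
  define D'' where "D'' \<epsilon> = (\<Sum>i\<in>UNIV. a i powr (2 * \<epsilon>) * (2 * ln (a i)) * (2 * ln (a i)))" for \<epsilon>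
  have a0: "a i \<noteq> 0" for i using a[of i] by simp
  have pos: "N \<epsilon> > 0" "D \<epsilon> > 0" for \<epsilon>
    unfolding N_def D_def by (intro sum_pos; simp add: a0)+
  have dN: "(N has_real_derivative N' \<epsilon>) (at \<epsilon>)" "(N' has_real_derivative N'' \<epsilon>) (at \<epsilon>)"
    and dD: "(D has_real_derivative D' \<epsilon>) (at \<epsilon>)" "(D' has_real_derivative D'' \<epsilon>) (at \<epsilon>)" for \<epsilon>
    unfolding N_def[abs_def] N'_def[abs_def] N''_def D_def[abs_def] D'_def[abs_def] D''_def
    using a by (auto intro!: derivative_eq_intros sum.cong simp: a0 algebra_simps)
  define F where "F \<epsilon> = N \<epsilon> / (c * sqrt (D \<epsilon>))" for \<epsilon>
  \<comment> \<open>The derivative is written as \<open>F\<close> times its logarithmic derivative,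
    so that at 0 the factor \<open>F 0\<close> splits off as in the claimed expansion.\<close>
  define F' where "F' \<epsilon> = F \<epsilon> * (N' \<epsilon> / N \<epsilon> - D' \<epsilon> / (2 * D \<epsilon>))" for \<epsilon>
  have dF: "(F has_real_derivative F' \<epsilon>) (at \<epsilon>)" for \<epsilon>
  proof -
    \<comment> \<open>With \<open>D \<epsilon> = s\<^sup>2\<close> the comparison with the quotient
      rule becomes an identity of rational functions.\<close>
    define s where "s = sqrt (D \<epsilon>)"
    have s: "s > 0" "D \<epsilon> = s\<^sup>2"
      using pos[of \<epsilon>] by (auto simp: s_def)
    have "((\<lambda>\<epsilon>. sqrt (D \<epsilon>)) has_real_derivative inverse s / 2 * D' \<epsilon>) (at \<epsilon>)"
      unfolding s_def by (intro DERIV_chain2[OF _ dD(1)] DERIV_real_sqrt pos)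
    from DERIV_cdivide[OF DERIV_divide[OF dN(1) this], of c]
    have "(F has_real_derivative (N' \<epsilon> * s - N \<epsilon> * (inverse s / 2 * D' \<epsilon>)) / (s * s) / c) (at \<epsilon>)"
      using s by (simp add: F_def[abs_def] s_def[symmetric] mult.commute[of c])
    moreover have "(N' \<epsilon> * s - N \<epsilon> * (inverse s / 2 * D' \<epsilon>)) / (s * s) / c = F' \<epsilon>"
    proof (cases "c = 0")
      case False
      with s show ?thesis
        using pos(1)[of \<epsilon>] unfolding F'_def F_def s_def[symmetric]
        by (simp add: field_simps power2_eq_square)
    qed (simp add: F'_def F_def)
    ultimately show ?thesis by simp
  qed
  have "F field_differentiable at 0" "N field_differentiable at 0" "N' field_differentiable at 0"
    "D field_differentiable at 0" "D' field_differentiable at 0"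
    unfolding field_differentiable_def by (rule exI, rule dF dN dD)+
  then have "F' field_differentiable at 0"
    unfolding F'_def[abs_def] using pos[of 0] by (intro derivative_intros) auto
  then obtain k where "(F' has_real_derivative k) (at 0)"
    by (auto simp: field_differentiable_def)
  then have "(\<lambda>\<epsilon>. F \<epsilon> - (F 0 + F' 0 * (\<epsilon> - 0))) \<in> O[at 0](\<lambda>\<epsilon>. (\<epsilon> - 0)\<^sup>2)"
    by (intro taylor_first_order_bigo always_eventually allI dF)
  moreover have "F 0 + F' 0 * \<epsilon> = (\<Sum>i\<in>UNIV. a i) / (c * sqrt (real CARD('d)))
        * (1 + \<epsilon> * ((\<Sum>i\<in>UNIV. a i * ln (a i)) / (\<Sum>i\<in>UNIV. a i)
          - (\<Sum>i\<in>UNIV. ln (a i)) / real CARD('d)))" for \<epsilon>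
  proof -
    \<comment> \<open>\<open>D 0\<close> counts the indices, as every \<open>a i powr 0\<close> is
      1. The factor 2 in \<open>D' 0\<close> cancels the one that the square root puts into the
      denominator.\<close>
    have "N 0 = (\<Sum>i\<in>UNIV. a i)" "N' 0 = (\<Sum>i\<in>UNIV. a i * ln (a i))"
      "D 0 = real CARD('d)" "D' 0 = 2 * (\<Sum>i\<in>UNIV. ln (a i))"
      using a by (simp_all add: N_def N'_def D_def D'_def a0 less_imp_le sum_distrib_left)
    then show ?thesis
      by (simp add: F'_def F_def algebra_simps)
  qed
  ultimately show ?thesis
    by (simp add: F_def N_def D_def)
qed

theorem proposition6p1:
  fixes loss :: "real ^ 'd \<Rightarrow> real"
    and x g \<delta>\<^sub>2 :: "real ^ 'd"
    and \<delta> :: "real \<Rightarrow> real ^ 'd"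
  assumes gradient: "GDERIV loss x :> g"
    and nonnull: "g \<noteq> 0"
    and l2: "l2_perturbation g \<delta>\<^sub>2"
    and lp: "\<And>p. p \<ge> 2 \<Longrightarrow> lp_perturbation p g (\<delta> p)"
  shows "(\<forall>p\<ge>2. \<forall>q\<in>{1..2}. 1 / p + 1 / q = 1 \<longrightarrow>
            cosine_similarity \<delta>\<^sub>2 (\<delta> p) =
              lp_norm q g powr q / (lp_norm 2 g * lp_norm (2 * (q - 1)) g powr (q - 1)))
       \<and> ((\<forall>i. normalized_component g i > 0) \<longrightarrow>
            (\<lambda>\<epsilon>. cosine_similarity \<delta>\<^sub>2 (\<delta> (dual_exponent (1 + \<epsilon>)))
                 - sqrt (participation_ratio g / real CARD('d))
                   * (1 + \<epsilon> * (log_mean_entropy g - shannon_entropy g)))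
              \<in> O[at_right 0](\<lambda>\<epsilon>. \<epsilon>\<^sup>2))"
proof (intro conjI allI ballI impI)
  fix p q :: real
  assume p: "2 \<le> p" and "q \<in> {1..2}" and pq: "1 / p + 1 / q = 1"
  \<comment> \<open>The value \<open>q = 1\<close> would force \<open>1 / p = 0\<close>, against
    \<open>p \<ge> 2\<close>.\<close>
  then have "q \<noteq> 1" and q: "q > 1" "dual_exponent p = q"
    using dual_exponent_eq_iff[of p q] by (auto simp: less_le)
  then show "cosine_similarity \<delta>\<^sub>2 (\<delta> p) =
      lp_norm q g powr q / (lp_norm 2 g * lp_norm (2 * (q - 1)) g powr (q - 1))"
    using cosine_similarity_perturbations[OF l2 lp[OF p] q(2,1)] lp_norm_powr_half[OF q(1), of g]
      lp_norm_powr_self[of q g]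
    by (simp add: lp_norm_2)
next
  assume pos: "\<forall>i. normalized_component g i > 0"
  then have g: "\<bar>g $ i\<bar> > 0" for i
    by (metis normalized_component_def div_0 less_irrefl zero_less_abs_iff abs_zero)
  define C where "C \<epsilon> = (\<Sum>i\<in>UNIV. \<bar>g $ i\<bar> powr (1 + \<epsilon>)) /
      (norm g * sqrt (\<Sum>i\<in>UNIV. \<bar>g $ i\<bar> powr (2 * \<epsilon>)))" for \<epsilon>
  define L where "L \<epsilon> = sqrt (participation_ratio g / real CARD('d))
      * (1 + \<epsilon> * (log_mean_entropy g - shannon_entropy g))" for \<epsilon>
  have "sqrt (participation_ratio g / real CARD('d)) =
      (\<Sum>i\<in>UNIV. \<bar>g $ i\<bar>) / (norm g * sqrt (real CARD('d)))"
    by (simp add: participation_ratio_def lp_norm_1 lp_norm_2 real_sqrt_divide sum_nonneg abs_divide)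
  then have "(\<lambda>\<epsilon>. C \<epsilon> - L \<epsilon>) \<in> O[at 0](\<lambda>\<epsilon>. \<epsilon>\<^sup>2)"
    using power_sum_ratio_expansion[where a = "\<lambda>i. \<bar>g $ i\<bar>" and c = "norm g", OF g] pos
    by (simp add: C_def L_def entropy_difference)
  \<comment> \<open>The closed form \<open>C\<close> is expanded on both sides of 0, but it is
    compared with the cosine only for positive \<open>\<epsilon>\<close>.\<close>
  then have "(\<lambda>\<epsilon>. C \<epsilon> - L \<epsilon>) \<in> O[at_right 0](\<lambda>\<epsilon>. \<epsilon>\<^sup>2)"
    by (rule landau_o.big.filter_mono[rotated]) (simp add: at_le)
  moreover have "\<forall>\<^sub>F \<epsilon> in at_right 0. cosine_similarity \<delta>\<^sub>2 (\<delta> (dual_exponent (1 + \<epsilon>))) - L \<epsilon>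
      = C \<epsilon> - L \<epsilon>"
    unfolding eventually_at_right_field
  \<comment> \<open>For \<open>0 < \<epsilon> < 1\<close> the dual exponent
    \<open>(1 + \<epsilon>) / \<epsilon>\<close> exceeds 2, so \<open>lp\<close> applies; taking the
    dual twice gives back \<open>1 + \<epsilon>\<close>.\<close>
  proof (intro exI[of _ 1] conjI allI impI)
    fix \<epsilon> :: real assume \<epsilon>: "0 < \<epsilon>" "\<epsilon> < 1"
    then have p: "dual_exponent (1 + \<epsilon>) \<ge> 2"
      and q: "dual_exponent (dual_exponent (1 + \<epsilon>)) = 1 + \<epsilon>"
      by (simp_all add: dual_exponent_def field_simps)
    show "cosine_similarity \<delta>\<^sub>2 (\<delta> (dual_exponent (1 + \<epsilon>))) - L \<epsilon> = C \<epsilon> - L \<epsilon>"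
      using cosine_similarity_perturbations[OF l2 lp[OF p] q] \<epsilon> by (simp add: C_def)
  qed simp
  ultimately show "(\<lambda>\<epsilon>. cosine_similarity \<delta>\<^sub>2 (\<delta> (dual_exponent (1 + \<epsilon>)))
       - sqrt (participation_ratio g / real CARD('d))
         * (1 + \<epsilon> * (log_mean_entropy g - shannon_entropy g)))
      \<in> O[at_right 0](\<lambda>\<epsilon>. \<epsilon>\<^sup>2)"
    unfolding L_def by (rule landau_o.big.in_cong[THEN iffD2, rotated])
qed

end
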